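(* Let $f\colon[0,1]\to[0,1]$ be a continuous function and let $\mathcal{C}$ be a closed, nowhere dense subset of $[0,1]$ that contains the critical points of $f$. Suppose that $f$ is $C^1$ with gradient modulus strictly greater than $1$ (i.e. $|f'(x)|>1$) on every interval in $(0,1)\setminus\mathcal{C}$. If $\Lambda$ is a closed subset of $[0,1]$ that is disjoint from $\mathcal{C}\cup\{0,1\}$, then $f$ has shadowing, s-limit shadowing and h-shadowing on $\Lambda$.
   Context: A critical point of a continuous map $f\colon[0,1]\to[0,1]$ is a point $x\in[0,1]$ at which $f$ fails to be locally one-to-one, i.e. there is no open subset $V\ni x$ of $[0,1]$ such that $f|_V$ is injective. Let $X=[0,1]$ with the usual metric $d$, and $\mathbb{N}=\{0,1,2,\dots\}$. For $\varepsilon>0$, a finite or infinite sequence $x_0,x_1,\dots$ in $X$ is an $\varepsilon$-pseudo-orbit if $d(f(x_n),x_{n+1})<\varepsilon$ for all $n\ge0$ (for which both terms are defined). An infinite $\varepsilon$-pseudo-orbit is an asymptotic $\varepsilon$-pseudo-orbit if in addition $d(f(x_n),x_{n+1})\to0$ as $n\to\infty$. A point $y\in X$ $\varepsilon$-shadows $\{x_n\}$ if $d(f^n(y),x_n)<\varepsilon$ for every index $n$; it asymptotically $\varepsilon$-shadows $\{x_n\}_{n\in\mathbb{N}}$ if in addition $\lim_{n\to\infty}d(f^n(y),x_n)=0$. Let $Y\subseteq X$. - $f$ has shadowing on $Y$ if for every $\varepsilon>0$ there is $\delta>0$ such that every infinite $\delta$-pseudo-orbit in $Y$ is $\varepsilon$-shadowed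 by a point $y\in X$. - $f$ has s-limit shadowing on $Y$ if for every $\varepsilon>0$ there is $\delta>0$ such that (i) every infinite $\delta$-pseudo-orbit in $Y$ is $\varepsilon$-shadowed by some $y\in X$, and (ii) every asymptotic $\delta$-pseudo-orbit in $Y$ is asymptotically $\varepsilon$-shadowed by some $y\in X$. - $f$ has h-shadowing on $Y$ if for every $\varepsilon>0$ there is $\delta>0$ such that for every finite $\delta$-pseudo-orbit $\{x_0,\dots,x_m\}\subseteq Y$ there is $y\in X$ with $d(f^i(y),x_i)<\varepsilon$ for every $i<m$ and $f^m(y)=x_m$. *)

theory Defs
  imports "HOL-Analysis.Analysis"
begin

text \<open>
  A map on a space \<open>X\<close> is represented by a total function of which only the values
  on the carrier set \<open>X\<close> matter.
\<close>

definition critical_point :: "'a::topological_space set \<Rightarrow> ('a \<Rightarrow> 'b) \<Rightarrow> 'a \<Rightarrow> bool" where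
  "critical_point X f x \<longleftrightarrow>
     x \<in> X \<and> \<not> (\<exists>V. openin (top_of_set X) V \<and> x \<in> V \<and> inj_on f V)"

definition nowhere_dense_in :: "'a topology \<Rightarrow> 'a set \<Rightarrow> bool" where
  "nowhere_dense_in T S \<longleftrightarrow>
     S \<subseteq> topspace T \<and> T interior_of (T closure_of S) = {}"

definition pseudo_orbit :: "('a::metric_space \<Rightarrow> 'a) \<Rightarrow> real \<Rightarrow> (nat \<Rightarrow> 'a) \<Rightarrow> bool" where
  "pseudo_orbit f \<delta> x \<longleftrightarrow> (\<forall>n. dist (f (x n)) (x (Suc n)) < \<delta>)"

text \<open>The finite sequence \<open>x 0, \<dots>, x m\<close>; values of \<open>x\<close> beyond \<open>m\<close> are irrelevant.\<close>

definition finite_pseudo_orbit ::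
    "('a::metric_space \<Rightarrow> 'a) \<Rightarrow> real \<Rightarrow> nat \<Rightarrow> (nat \<Rightarrow> 'a) \<Rightarrow> bool" where
  "finite_pseudo_orbit f \<delta> m x \<longleftrightarrow> (\<forall>n<m. dist (f (x n)) (x (Suc n)) < \<delta>)"

definition asymptotic_pseudo_orbit ::
    "('a::metric_space \<Rightarrow> 'a) \<Rightarrow> real \<Rightarrow> (nat \<Rightarrow> 'a) \<Rightarrow> bool" where
  "asymptotic_pseudo_orbit f \<delta> x \<longleftrightarrow>
     pseudo_orbit f \<delta> x \<and> (\<lambda>n. dist (f (x n)) (x (Suc n))) \<longlonglongrightarrow> 0"

definition shadows ::
    "('a::metric_space \<Rightarrow> 'a) \<Rightarrow> real \<Rightarrow> 'a \<Rightarrow> (nat \<Rightarrow> 'a) \<Rightarrow> bool" where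
  "shadows f \<epsilon> y x \<longleftrightarrow> (\<forall>n. dist ((f ^^ n) y) (x n) < \<epsilon>)"

definition asymptotically_shadows ::
    "('a::metric_space \<Rightarrow> 'a) \<Rightarrow> real \<Rightarrow> 'a \<Rightarrow> (nat \<Rightarrow> 'a) \<Rightarrow> bool" where
  "asymptotically_shadows f \<epsilon> y x \<longleftrightarrow>
     shadows f \<epsilon> y x \<and> (\<lambda>n. dist ((f ^^ n) y) (x n)) \<longlonglongrightarrow> 0"

text \<open>
  In the following, pseudo-orbits lie in \<open>Y\<close>, while the shadowing point is only
  required to lie in the whole space \<open>X\<close>.
\<close>

definition has_shadowing_on ::
    "'a::metric_space set \<Rightarrow> ('a \<Rightarrow> 'a) \<Rightarrow> 'a set \<Rightarrow> bool" where
  "has_shadowing_on X f Y \<longleftrightarrow>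
     (\<forall>\<epsilon>>0. \<exists>\<delta>>0. \<forall>x. range x \<subseteq> Y \<and> pseudo_orbit f \<delta> x \<longrightarrow> (\<exists>y\<in>X. shadows f \<epsilon> y x))"

definition has_s_limit_shadowing_on ::
    "'a::metric_space set \<Rightarrow> ('a \<Rightarrow> 'a) \<Rightarrow> 'a set \<Rightarrow> bool" where
  "has_s_limit_shadowing_on X f Y \<longleftrightarrow>
     (\<forall>\<epsilon>>0. \<exists>\<delta>>0.
        (\<forall>x. range x \<subseteq> Y \<and> pseudo_orbit f \<delta> x \<longrightarrow> (\<exists>y\<in>X. shadows f \<epsilon> y x)) \<and>
        (\<forall>x. range x \<subseteq> Y \<and> asymptotic_pseudo_orbit f \<delta> x \<longrightarrow>
             (\<exists>y\<in>X. asymptotically_shadows f \<epsilon> y x)))"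

definition has_h_shadowing_on ::
    "'a::metric_space set \<Rightarrow> ('a \<Rightarrow> 'a) \<Rightarrow> 'a set \<Rightarrow> bool" where
  "has_h_shadowing_on X f Y \<longleftrightarrow>
     (\<forall>\<epsilon>>0. \<exists>\<delta>>0. \<forall>m x. x ` {..m} \<subseteq> Y \<and> finite_pseudo_orbit f \<delta> m x \<longrightarrow>
        (\<exists>y\<in>X. (\<forall>i<m. dist ((f ^^ i) y) (x i) < \<epsilon>) \<and> (f ^^ m) y = x m))"

end

theory Submission
  imports Defs
begin

text \<open>
  By compactness \<open>f\<close> expands distances by a uniform factor \<open>\<lambda> > 1\<close> on all balls of some
  fixed radius \<open>r\<close> centred in \<open>\<Lambda>\<close>, so for \<open>s \<le> r\<close> the image of the \<open>s\<close>-ball at \<open>x\<close>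
  covers the \<open>\<lambda> s\<close>-ball at \<open>f x\<close>. Along a \<open>(\<lambda> - 1) s\<close>-pseudo-orbit each \<open>s\<close>-ball is
  therefore covered by the image of the previous one; pulling back the last point gives
  h-shadowing, and a limit of such pullbacks gives shadowing. The errors of any shadowing
  orbit satisfy \<open>\<lambda> e\<^sub>n \<le> e\<^sub>n\<^sub>+\<^sub>1 + \<delta>\<^sub>n\<close>, so they tend to zero whenever the \<open>\<delta>\<^sub>n\<close> do.
\<close>

section \<open>Decay of error sequences\<close>

text \<open>Iterating \<open>step\<close> forward \<open>k\<close> times divides the bound
  \<open>B\<close> by \<open>l ^ k\<close>, while the small \<open>d\<close> add at most a geometric
  series. Boundedness matters: \<open>e n = l ^ n\<close> with \<open>d = 0\<close> satisfies the
  recursion.\<close>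

lemma backward_contraction_tendsto_0:
  fixes e d :: "nat \<Rightarrow> real"
  assumes l: "l > 1" and e0: "\<And>n. 0 \<le> e n" and eB: "\<And>n. e n \<le> B"
    and step: "\<And>n. l * e n \<le> e (Suc n) + d n" and d: "d \<longlonglongrightarrow> 0"
  shows "e \<longlonglongrightarrow> 0"
proof (rule LIMSEQ_I)
  fix \<eta> :: real assume "\<eta> > 0"
  define h where "h = \<eta> / 2"
  have h: "h > 0" "h < \<eta>" using \<open>\<eta> > 0\<close> by (auto simp: h_def)
  \<comment> \<open>This threshold makes \<open>h\<close> the fixed point of
    \<open>t \<mapsto> (t + h * (l - 1)) / l\<close>, so the accumulated errors stay below
    \<open>h\<close>.\<close>
  then obtain N where N: "\<And>n. n \<ge> N \<Longrightarrow> \<bar>d n\<bar> < h * (l - 1)"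
    using LIMSEQ_D[OF d, of "h * (l - 1)"] l by auto
  have bound: "e n \<le> B / l ^ k + h" if "n \<ge> N" for n k
    using that
  proof (induction k arbitrary: n)
    case 0
    then show ?case using eB[of n] h by simp
  next
    case (Suc k)
    have "l * e n \<le> B / l ^ k + h + h * (l - 1)"
      using step[of n] Suc.IH[of "Suc n"] N[of n] Suc.prems by auto
    also have "\<dots> = l * (B / l ^ Suc k + h)"
      using l by (simp add: field_simps)
    finally show ?case using l by simp
  qed
  have "(\<lambda>k. B / l ^ k + h) \<longlonglongrightarrow> 0 + h"
    by (intro tendsto_add tendsto_const LIMSEQ_divide_realpow_zero l)
  then have "e n \<le> h" if "n \<ge> N" for n
    using LIMSEQ_le_const[of "\<lambda>k. B / l ^ k + h" h "e n"] bound[OF that] by auto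
  then show "\<exists>N. \<forall>n\<ge>N. norm (e n - 0) < \<eta>"
    using h e0 by (intro exI[of _ N]) (auto intro: le_less_trans)
qed

section \<open>Shadowing from uniform expansion near a set\<close>

text \<open>\<open>covers\<close> yields shadowing points by pulling back, \<open>ball_sub\<close>
  keeps them in \<open>X\<close>, and \<open>expands\<close> forces shadowing errors to
  decay.\<close>

locale expanding_near =
  fixes X :: "'a::metric_space set" and f :: "'a \<Rightarrow> 'a" and Y :: "'a set" and r l :: real
  assumes compact_X: "compact X" and cont: "continuous_on X f" and maps: "f ` X \<subseteq> X"
    and r_pos: "r > 0" and l_gt_1: "l > 1"
    and ball_sub: "\<And>y. y \<in> Y \<Longrightarrow> cball y r \<subseteq> X"
    and covers: "\<And>y s. y \<in> Y \<Longrightarrow> 0 < s \<Longrightarrow> s \<le> r \<Longrightarrow> cball (f y) (l * s) \<subseteq> f ` cball y s"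
    and expands: "\<And>y z. y \<in> Y \<Longrightarrow> z \<in> cball y r \<Longrightarrow> l * dist y z \<le> dist (f y) (f z)"
begin

lemma funpow_maps: "y \<in> X \<Longrightarrow> (f ^^ n) y \<in> X"
  using maps by (induction n) auto

lemma continuous_on_funpow: "continuous_on X (f ^^ n)"
proof (induction n)
  case (Suc n)
  have "continuous_on X (\<lambda>y. f ((f ^^ n) y))"
    by (rule continuous_on_compose2[OF cont Suc]) (use funpow_maps in auto)
  then show ?case by (simp add: o_def)
qed (simp add: id_def)

text \<open>Induction peels off the first point. A shadow \<open>y\<close> of the tail is within
  \<open>s\<close> of \<open>x 1\<close>, hence within \<open>(l - 1) * s + s = l * s\<close> of
  \<open>f (x 0)\<close>, so it has a preimage in the \<open>s\<close>-ball at \<open>x 0\<close>.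
  Taking preimages leaves the exact hit at the end intact.\<close>

lemma finite_shadow:
  assumes s: "0 < s" "s \<le> r"
    and "x ` {..m} \<subseteq> Y" and "finite_pseudo_orbit f ((l - 1) * s) m x"
  shows "\<exists>y\<in>X. (\<forall>i\<le>m. dist ((f ^^ i) y) (x i) \<le> s) \<and> (f ^^ m) y = x m"
  using assms(3,4)
proof (induction m arbitrary: x)
  case 0
  then have "x 0 \<in> X" using ball_sub[of "x 0"] r_pos by auto
  then show ?case using s by (intro bexI[of _ "x 0"]) auto
next
  case (Suc m)
  define x' where "x' = x \<circ> Suc"
  have "x' ` {..m} \<subseteq> Y" "finite_pseudo_orbit f ((l - 1) * s) m x'"
    using Suc.prems by (auto simp: x'_def finite_pseudo_orbit_def)
  from Suc.IH[OF this] obtain y where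
    y: "\<And>i. i \<le> m \<Longrightarrow> dist ((f ^^ i) y) (x' i) \<le> s" "(f ^^ m) y = x' m"
    by blast
  have x0: "x 0 \<in> Y" and d0: "dist (f (x 0)) (x 1) < (l - 1) * s"
    using Suc.prems by (auto simp: finite_pseudo_orbit_def)
  have "dist (f (x 0)) y \<le> dist (f (x 0)) (x 1) + dist y (x 1)"
    by (rule dist_triangle2)
  also have "\<dots> \<le> l * s"
    using d0 y(1)[of 0] by (simp add: x'_def algebra_simps)
  finally obtain z where z: "z \<in> cball (x 0) s" "y = f z"
    using covers[OF x0 s] by auto
  have "z \<in> X" using z(1) s ball_sub[OF x0] by auto
  moreover have "dist ((f ^^ i) z) (x i) \<le> s" if "i \<le> Suc m" for i
    using that z y(1) by (cases i) (auto simp: x'_def funpow_swap1 dist_commute)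
  moreover have "(f ^^ Suc m) z = x (Suc m)"
    using y(2) z(2) by (simp add: x'_def funpow_swap1)
  ultimately show ?case by blast
qed

text \<open>A limit point of the shadows of the initial segments works: each iterate is continuous,
  and the non-strict bound survives the limit.\<close>

lemma infinite_shadow:
  assumes s: "0 < s" "s \<le> r" and x: "range x \<subseteq> Y" and po: "pseudo_orbit f ((l - 1) * s) x"
  shows "\<exists>y\<in>X. \<forall>n. dist ((f ^^ n) y) (x n) \<le> s"
proof -
  have "\<exists>y\<in>X. \<forall>i\<le>m. dist ((f ^^ i) y) (x i) \<le> s" for m
  proof -
    have "x ` {..m} \<subseteq> Y" "finite_pseudo_orbit f ((l - 1) * s) m x"
      using x po by (auto simp: pseudo_orbit_def finite_pseudo_orbit_def)
    from finite_shadow[OF s this] show ?thesis by blast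
  qed
  then obtain Z where ZX: "\<And>m. Z m \<in> X"
    and Z: "\<And>m i. i \<le> m \<Longrightarrow> dist ((f ^^ i) (Z m)) (x i) \<le> s"
    by metis
  obtain y \<sigma> where y: "y \<in> X" and \<sigma>: "strict_mono \<sigma>" and lim: "(Z \<circ> \<sigma>) \<longlonglongrightarrow> y"
    using compact_X ZX unfolding compact_def by meson
  have "dist ((f ^^ n) y) (x n) \<le> s" for n
  proof (rule LIMSEQ_le_const2)
    have "(\<lambda>k. (f ^^ n) ((Z \<circ> \<sigma>) k)) \<longlonglongrightarrow> (f ^^ n) y"
      using continuous_on_tendsto_compose[OF continuous_on_funpow lim y] ZX by auto
    then show "(\<lambda>k. dist ((f ^^ n) ((Z \<circ> \<sigma>) k)) (x n)) \<longlonglongrightarrow> dist ((f ^^ n) y) (x n)"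
      by (intro tendsto_intros)
    \<comment> \<open>\<open>\<sigma> k \<ge> k\<close>, so from \<open>k = n\<close> on the segment
      shadowed by \<open>Z (\<sigma> k)\<close> includes index \<open>n\<close>.\<close>
    show "\<exists>N. \<forall>k\<ge>N. dist ((f ^^ n) ((Z \<circ> \<sigma>) k)) (x n) \<le> s"
      using Z order_trans[OF _ seq_suble[OF \<sigma>]] by (intro exI[of _ n]) auto
  qed
  then show ?thesis using y by blast
qed

text \<open>Expansion at \<open>x n\<close> and the triangle inequality give the recursion for the
  errors, with \<open>r\<close> as their bound.\<close>

lemma shadow_imp_asymptotic:
  assumes x: "range x \<subseteq> Y" and asy: "(\<lambda>n. dist (f (x n)) (x (Suc n))) \<longlonglongrightarrow> 0"
    and sh: "\<And>n. dist ((f ^^ n) y) (x n) \<le> r"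
  shows "(\<lambda>n. dist ((f ^^ n) y) (x n)) \<longlonglongrightarrow> 0"
proof (rule backward_contraction_tendsto_0[OF l_gt_1 _ sh _ asy])
  fix n
  have "l * dist (x n) ((f ^^ n) y) \<le> dist (f (x n)) ((f ^^ Suc n) y)"
    using expands[of "x n" "(f ^^ n) y"] x sh[of n] by (auto simp: dist_commute)
  also have "\<dots> \<le> dist (f (x n)) (x (Suc n)) + dist ((f ^^ Suc n) y) (x (Suc n))"
    by (rule dist_triangle2)
  finally show "l * dist ((f ^^ n) y) (x n)
      \<le> dist ((f ^^ Suc n) y) (x (Suc n)) + dist (f (x n)) (x (Suc n))"
    by (simp add: dist_commute)
qed simp

text \<open>A radius strictly below \<epsilon> turns the closed bounds \<open>\<le> s\<close> into
  the strict ones of the definitions; \<open>(l - 1) * s\<close> then serves as \<delta>.\<close>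

lemma scale_below:
  assumes "\<epsilon> > 0"
  obtains s where "0 < s" "s \<le> r" "s < \<epsilon>" "(l - 1) * s > 0"
proof (rule that)
  show "0 < min r (\<epsilon> / 2)" "min r (\<epsilon> / 2) \<le> r" "min r (\<epsilon> / 2) < \<epsilon>"
    using assms r_pos by auto
  then show "(l - 1) * min r (\<epsilon> / 2) > 0"
    using l_gt_1 by (intro mult_pos_pos) auto
qed

lemma has_s_limit_shadowing: "has_s_limit_shadowing_on X f Y"
  unfolding has_s_limit_shadowing_on_def
proof (intro allI impI)
  fix \<epsilon> :: real assume "\<epsilon> > 0"
  then obtain s where s: "0 < s" "s \<le> r" "s < \<epsilon>" "(l - 1) * s > 0" by (rule scale_below)
  have "\<exists>y\<in>X. shadows f \<epsilon> y x" if "range x \<subseteq> Y" "pseudo_orbit f ((l - 1) * s) x" for x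
    using infinite_shadow[OF s(1,2) that] s(3) unfolding shadows_def by (meson le_less_trans)
  moreover have "\<exists>y\<in>X. asymptotically_shadows f \<epsilon> y x"
    if x: "range x \<subseteq> Y" and asy: "asymptotic_pseudo_orbit f ((l - 1) * s) x" for x
  proof -
    \<comment> \<open>The point from ordinary shadowing already shadows asymptotically, so one
      \<delta> serves both clauses.\<close>
    obtain y where y: "y \<in> X" "\<And>n. dist ((f ^^ n) y) (x n) \<le> s"
      using infinite_shadow[OF s(1,2) x] asy unfolding asymptotic_pseudo_orbit_def by blast
    have "dist ((f ^^ n) y) (x n) \<le> r" "dist ((f ^^ n) y) (x n) < \<epsilon>" for n
      using y(2)[of n] s by auto
    with shadow_imp_asymptotic[OF x, of y] asy y(1) show ?thesis
      unfolding asymptotically_shadows_def shadows_def asymptotic_pseudo_orbit_def by blast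
  qed
  ultimately show "\<exists>\<delta>>0.
      (\<forall>x. range x \<subseteq> Y \<and> pseudo_orbit f \<delta> x \<longrightarrow> (\<exists>y\<in>X. shadows f \<epsilon> y x)) \<and>
      (\<forall>x. range x \<subseteq> Y \<and> asymptotic_pseudo_orbit f \<delta> x \<longrightarrow>
           (\<exists>y\<in>X. asymptotically_shadows f \<epsilon> y x))"
    using s(4) by blast
qed

lemma has_shadowing: "has_shadowing_on X f Y"
  unfolding has_shadowing_on_def
proof (intro allI impI)
  fix \<epsilon> :: real assume "\<epsilon> > 0"
  with has_s_limit_shadowing
  show "\<exists>\<delta>>0. \<forall>x. range x \<subseteq> Y \<and> pseudo_orbit f \<delta> x \<longrightarrow> (\<exists>y\<in>X. shadows f \<epsilon> y x)"
    unfolding has_s_limit_shadowing_on_def by blast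
qed

lemma has_h_shadowing: "has_h_shadowing_on X f Y"
  unfolding has_h_shadowing_on_def
proof (intro allI impI)
  fix \<epsilon> :: real assume "\<epsilon> > 0"
  then obtain s where s: "0 < s" "s \<le> r" "s < \<epsilon>" "(l - 1) * s > 0" by (rule scale_below)
  have "\<exists>y\<in>X. (\<forall>i<m. dist ((f ^^ i) y) (x i) < \<epsilon>) \<and> (f ^^ m) y = x m"
    if po: "x ` {..m} \<subseteq> Y" "finite_pseudo_orbit f ((l - 1) * s) m x" for m x
  proof -
    obtain y where "y \<in> X" "\<forall>i\<le>m. dist ((f ^^ i) y) (x i) \<le> s" "(f ^^ m) y = x m"
      using finite_shadow[OF s(1,2) po] by blast
    then show ?thesis using s(3) by (intro bexI[of _ y]) (auto intro: le_less_trans[OF _ s(3)])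
  qed
  then show "\<exists>\<delta>>0. \<forall>m x. x ` {..m} \<subseteq> Y \<and> finite_pseudo_orbit f \<delta> m x \<longrightarrow>
      (\<exists>y\<in>X. (\<forall>i<m. dist ((f ^^ i) y) (x i) < \<epsilon>) \<and> (f ^^ m) y = x m)"
    using s(4) by blast
qed

end

section \<open>Expansion and covering on the real line\<close>

text \<open>Expansion makes \<open>f\<close> injective, so continuity puts \<open>f x\<close>
  strictly between the endpoint images. Each of these is at least \<open>l * s\<close> away, and
  connectedness fills the gap.\<close>

lemma expanding_interval_covers:
  fixes f :: "real \<Rightarrow> real"
  assumes s: "s > 0" and l: "l > 0" and cont: "continuous_on (cball x s) f"
    and ex: "\<And>a b. a \<in> cball x s \<Longrightarrow> b \<in> cball x s \<Longrightarrow> l * dist a b \<le> dist (f a) (f b)"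
  shows "cball (f x) (l * s) \<subseteq> f ` cball x s"
proof -
  have cb: "cball x s = {x - s..x + s}" by (simp add: cball_eq_atLeastAtMost)
  have "inj_on f {x - s..x + s}"
  proof (rule inj_onI)
    fix a b assume "a \<in> {x - s..x + s}" "b \<in> {x - s..x + s}" "f a = f b"
    then have "l * dist a b \<le> 0" using ex[of a b] by (simp add: cb)
    then show "a = b" using l by (simp add: mult_le_0_iff)
  qed
  then have sides: "f (x - s) < f x \<and> f x < f (x + s) \<or> f (x + s) < f x \<and> f x < f (x - s)"
    using continuous_inj_imp_mono[of "x - s" x "x + s" f] cont s by (auto simp: cb)
  have far: "l * s \<le> \<bar>f (x - s) - f x\<bar>" "l * s \<le> \<bar>f (x + s) - f x\<bar>"
    using ex[of "x - s" x] ex[of "x + s" x] s by (auto simp: dist_real_def)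
  have "connected (f ` cball x s)"
    using cont by (rule connected_continuous_image) simp
  moreover have "f (x - s) \<in> f ` cball x s" "f (x + s) \<in> f ` cball x s"
    using s by (auto simp: dist_real_def)
  \<comment> \<open>One inclusion for increasing and one for decreasing \<open>f\<close>; the other
    interval is empty.\<close>
  ultimately have
    "{f (x - s)..f (x + s)} \<subseteq> f ` cball x s" "{f (x + s)..f (x - s)} \<subseteq> f ` cball x s"
    by (auto intro: connected_contains_Icc[THEN subsetD])
  then show ?thesis
    using sides far by (fastforce simp: cball_eq_atLeastAtMost)
qed

text \<open>Mean value theorem; the intermediate point stays in \<open>I\<close> because
  \<open>I\<close> is an interval.\<close>

lemma derivative_bound_imp_expanding:
  fixes f :: "real \<Rightarrow> real"
  assumes I: "is_interval I"
    and df: "\<And>x. x \<in> I \<Longrightarrow> f differentiable (at x)"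
    and bd: "\<And>x. x \<in> I \<Longrightarrow> l \<le> \<bar>deriv f x\<bar>"
    and ab: "a \<in> I" "b \<in> I"
  shows "l * dist a b \<le> dist (f a) (f b)"
proof -
  have lt: "l * dist a b \<le> dist (f a) (f b)" if "a < b" "a \<in> I" "b \<in> I" for a b
  proof -
    have sub: "x \<in> I" if "a \<le> x" "x \<le> b" for x
      by (rule mem_is_interval_1_I[OF I \<open>a \<in> I\<close> \<open>b \<in> I\<close> that])
    obtain z where z: "a < z" "z < b" "f b - f a = (b - a) * deriv f z"
      using MVT2[OF \<open>a < b\<close>, of f "deriv f"] df[OF sub]
      unfolding DERIV_deriv_iff_real_differentiable by blast
    have "l * (b - a) \<le> \<bar>deriv f z\<bar> * (b - a)"
      using bd[OF sub, of z] z \<open>a < b\<close> by (intro mult_right_mono) auto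
    then show ?thesis
      using z(3) \<open>a < b\<close>
      by (simp add: dist_real_def abs_minus_commute[of "f a"] abs_mult mult.commute)
  qed
  show ?thesis
    using lt[of a b] lt[of b a] ab by (cases a b rule: linorder_cases) (auto simp: dist_commute)
qed

text \<open>The definition only provides some continuous derivative \<open>D\<close>; uniqueness of
  derivatives identifies it with \<open>deriv f\<close>.\<close>

lemma C1_differentiable_on_imp_deriv:
  fixes f :: "real \<Rightarrow> real"
  assumes "f C1_differentiable_on S" "open S"
  shows "continuous_on S (deriv f)" and "x \<in> S \<Longrightarrow> f differentiable (at x)"
proof -
  obtain D where D: "\<And>x. x \<in> S \<Longrightarrow> (f has_real_derivative D x) (at x)" "continuous_on S D"
    using assms(1) unfolding C1_differentiable_on_def
    by (auto simp: has_real_derivative_iff_has_vector_derivative)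
  show "continuous_on S (deriv f)"
    using D(2) by (rule continuous_on_eq) (simp add: DERIV_imp_deriv[OF D(1)])
  show "x \<in> S \<Longrightarrow> f differentiable (at x)"
    using D(1) real_differentiable_def by blast
qed

section \<open>Uniform expansion around \<open>\<Lambda>\<close> by compactness\<close>

theorem theorem5p2:
  fixes f :: "real \<Rightarrow> real" and C \<Lambda> :: "real set"
  assumes "continuous_on {0..1} f" and "f ` {0..1} \<subseteq> {0..1}"
    and "C \<subseteq> {0..1}" and "closed C" and "nowhere_dense_in (top_of_set {0..1}) C"
    and "{x. critical_point {0..1} f x} \<subseteq> C"
    and "\<And>I. is_interval I \<Longrightarrow> I \<subseteq> {0<..<1} - C \<Longrightarrow>
           f C1_differentiable_on I \<and> (\<forall>x\<in>I. \<bar>deriv f x\<bar> > 1)"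
    and "\<Lambda> \<subseteq> {0..1}" and "closed \<Lambda>" and "\<Lambda> \<inter> (C \<union> {0, 1}) = {}"
  shows "has_shadowing_on {0..1} f \<Lambda> \<and> has_s_limit_shadowing_on {0..1} f \<Lambda> \<and>
         has_h_shadowing_on {0..1} f \<Lambda>"
\<comment> \<open>\<open>infdist\<close> to the empty set is 0 by convention, so the neighbourhood
  \<open>K\<close> below would be the whole line. No pseudo-orbit lies in the empty set, so any
  \<delta> works there.\<close>
proof (cases "\<Lambda> = {}")
  case True
  have "\<exists>\<delta>::real. \<delta> > 0" by (rule exI[of _ 1]) simp
  moreover have "\<not> range x \<subseteq> \<Lambda>" "\<not> x ` {..m} \<subseteq> \<Lambda>" for x and m :: nat
    using True by auto
  ultimately show ?thesis
    unfolding has_shadowing_on_def has_s_limit_shadowing_on_def has_h_shadowing_on_def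
    by blast
next
  case False
  define U where "U = {0<..<1} - C"
  have "open U" using assms(4) by (simp add: U_def open_Diff)
  have loc: "continuous (at x) (deriv f) \<and> f differentiable (at x) \<and> \<bar>deriv f x\<bar> > 1"
    if xU: "x \<in> U" for x
  proof -
    \<comment> \<open>A ball is an interval, so the hypothesis on intervals applies near each point
      of \<open>U\<close>.\<close>
    obtain e where e: "e > 0" "ball x e \<subseteq> U"
      using openE[OF \<open>open U\<close> xU] by blast
    have *: "f C1_differentiable_on ball x e" "\<forall>y\<in>ball x e. \<bar>deriv f y\<bar> > 1"
      using assms(7)[of "ball x e"] e(2)
      by (auto simp: U_def is_interval_connected_1)
    then show ?thesis
      using C1_differentiable_on_imp_deriv[OF *(1)] e(1)
      by (auto simp: continuous_on_eq_continuous_at)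
  qed
  have "compact \<Lambda>"
    using assms(8,9) by (meson bounded_closed_interval bounded_subset compact_eq_bounded_closed)
  moreover have "\<Lambda> \<subseteq> U" using assms(8,10) by (force simp: U_def)
  ultimately obtain r where r: "r > 0" "{x. infdist x \<Lambda> \<le> r} \<subseteq> U"
    using compact_in_open_separated[of \<Lambda> U] False \<open>open U\<close> by blast
  define K where "K = {x. infdist x \<Lambda> \<le> r}"
  have "compact K" unfolding K_def
    using compact_infdist_le[OF False \<open>compact \<Lambda>\<close> \<open>r > 0\<close>] .
  moreover have "K \<noteq> {}"
  proof -
    have "\<Lambda> \<subseteq> K" using r(1) by (auto simp: K_def)
    then show ?thesis using False by blast
  qed
  moreover have "continuous_on K (\<lambda>x. \<bar>deriv f x\<bar>)"
    using loc r(2)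
    by (intro continuous_at_imp_continuous_on ballI isCont_rabs) (auto simp: K_def)
  \<comment> \<open>The minimum is taken over \<open>K\<close>, not just \<open>\<Lambda>\<close>,
    since the mean value argument meets every point of the balls. Being attained in
    \<open>U\<close>, it exceeds 1 strictly.\<close>
  ultimately obtain k where k: "k \<in> K" "\<And>x. x \<in> K \<Longrightarrow> \<bar>deriv f k\<bar> \<le> \<bar>deriv f x\<bar>"
    using continuous_attains_inf[of K "\<lambda>x. \<bar>deriv f x\<bar>"] by blast
  define l where "l = \<bar>deriv f k\<bar>"
  have l: "l > 1" using loc k(1) r(2) by (auto simp: l_def K_def)
  have ballK: "cball x r \<subseteq> K" if "x \<in> \<Lambda>" for x
    using infdist_le2[OF that] by (auto simp: K_def dist_commute)
  have KU: "K \<subseteq> U" using r(2) by (simp add: K_def)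
  have ballX: "cball x r \<subseteq> {0..1}" if "x \<in> \<Lambda>" for x
    using ballK[OF that] KU by (force simp: U_def)
  have ex: "l * dist a b \<le> dist (f a) (f b)"
    if "x \<in> \<Lambda>" "a \<in> cball x r" "b \<in> cball x r" for x a b
  proof (rule derivative_bound_imp_expanding[OF _ _ _ that(2,3)])
    show "is_interval (cball x r)" by (simp add: is_interval_connected_1)
    fix z assume "z \<in> cball x r"
    then have "z \<in> K" using ballK[OF that(1)] by blast
    then show "f differentiable (at z)" "l \<le> \<bar>deriv f z\<bar>"
      using KU loc k(2) by (auto simp: l_def)
  qed
  interpret expanding_near "{0..1}" f \<Lambda> r l
  proof
    show "cball (f y) (l * s) \<subseteq> f ` cball y s" if "y \<in> \<Lambda>" "0 < s" "s \<le> r" for y s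
    proof (rule expanding_interval_covers)
      have "cball y s \<subseteq> cball y r" using that by auto
      then show "continuous_on (cball y s) f"
        using continuous_on_subset[OF assms(1)] ballX[OF that(1)] by blast
    qed (use that l ex[OF that(1)] in auto)
    show "l * dist y z \<le> dist (f y) (f z)" if "y \<in> \<Lambda>" "z \<in> cball y r" for y z
      using ex[OF that(1) _ that(2), of y] r(1) by simp
  qed (use assms(1,2) r(1) l ballX in auto)
  show ?thesis
    using has_shadowing has_s_limit_shadowing has_h_shadowing by blast
qed

end
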